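(* There is an $O(n(n+m))$-time algorithm which, given a graph $G$ with $n$ vertices and $m$ edges and without cycles of lengths $4$ and $6$, and a vertex $v\in V(G)$, decides whether $v$ is shedding.
   Context: Graphs are finite, simple, undirected; "without cycles of lengths 4 and 6" means no cycle of length 4 or 6 as a subgraph. $N(v)$ is the neighbourhood of $v$, $N[v]=N(v)\cup\{v\}$. A set is independent if its vertices are pairwise nonadjacent. A vertex $v$ is shedding if for every independent set $S\subseteq V(G)\setminus N[v]$ there exists $u\in N(v)$ such that $S\cup\{u\}$ is independent. *)

theory Defs
  imports Main
begin

section \<open>Graphs\<close>

definition simple_graph :: "'a set \<Rightarrow> 'a set set \<Rightarrow> bool" where
  "simple_graph V E \<longleftrightarrow> finite V \<and> (\<forall>e\<in>E. e \<subseteq> V \<and> card e = 2)"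

definition nbh :: "'a set set \<Rightarrow> 'a \<Rightarrow> 'a set" where
  "nbh E v = {u. {v, u} \<in> E}"

definition closed_nbh :: "'a set set \<Rightarrow> 'a \<Rightarrow> 'a set" where
  "closed_nbh E v = nbh E v \<union> {v}"

definition independent :: "'a set set \<Rightarrow> 'a set \<Rightarrow> bool" where
  "independent E S \<longleftrightarrow> (\<forall>x\<in>S. \<forall>y\<in>S. {x, y} \<notin> E)"

text \<open>Cycles are subgraphs, not necessarily induced.\<close>

definition has_cycle :: "'a set set \<Rightarrow> nat \<Rightarrow> bool" where
  "has_cycle E k \<longleftrightarrow> k \<ge> 3 \<and>
     (\<exists>ws. length ws = k \<and> distinct ws \<and> (\<forall>i<k. {ws ! i, ws ! (Suc i mod k)} \<in> E))"

definition shedding :: "'a set \<Rightarrow> 'a set set \<Rightarrow> 'a \<Rightarrow> bool" where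
  "shedding V E v \<longleftrightarrow>
     (\<forall>S. S \<subseteq> V - closed_nbh E v \<and> independent E S \<longrightarrow>
        (\<exists>u\<in>nbh E v. independent E (S \<union> {u})))"

section \<open>Random access machine\<close>

text \<open>
  Algorithms are structured programs for a random access machine.  A state consists of
  registers, named by constants in the program text, and of a memory, accessed only through
  addresses held in registers (indirect addressing).  Each elementary instruction and each
  evaluation of a branch or loop condition takes one unit of time.
\<close>

type_synonym state = "(nat \<Rightarrow> nat) \<times> (nat \<Rightarrow> nat)"

datatype cond =
    Less nat nat
  | Eq nat nat

datatype com =
    Skip
  | Imm nat nat
  | Copy nat nat
  | Add nat nat nat
  | Sub nat nat nat
  | Load nat nat
  | Store nat nat
  | Seq com com
  | If cond com com
  | While cond com

fun holds :: "cond \<Rightarrow> (nat \<Rightarrow> nat) \<Rightarrow> bool" where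
  "holds (Less r q) R \<longleftrightarrow> R r < R q"
| "holds (Eq r q) R \<longleftrightarrow> R r = R q"

text \<open>
  \<open>exec B c s t s'\<close>: started in \<open>s\<close>, the program \<open>c\<close> halts in \<open>s'\<close> after exactly \<open>t\<close> time
  units, on a machine whose words hold the numbers \<open>0, \<dots>, B\<close>.  Producing a number
  larger than \<open>B\<close> is an error: such a run has no derivation.  With
  \<open>B\<close> polynomial in the input size, words have logarithmically many bits, so that unit cost is
  realistic.  Subtraction is truncated at 0.
\<close>

inductive exec :: "nat \<Rightarrow> com \<Rightarrow> state \<Rightarrow> nat \<Rightarrow> state \<Rightarrow> bool" for B :: nat where
  Skip: "exec B Skip s 1 s"
| Imm: "k \<le> B \<Longrightarrow> exec B (Imm r k) (R, M) 1 (R(r := k), M)"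
| Copy: "exec B (Copy r q) (R, M) 1 (R(r := R q), M)"
| Add: "R p + R q \<le> B \<Longrightarrow> exec B (Add r p q) (R, M) 1 (R(r := R p + R q), M)"
| Sub: "exec B (Sub r p q) (R, M) 1 (R(r := R p - R q), M)"
| Load: "exec B (Load r q) (R, M) 1 (R(r := M (R q)), M)"
| Store: "exec B (Store r q) (R, M) 1 (R, M(R r := R q))"
| Seq: "exec B c\<^sub>1 s t\<^sub>1 s' \<Longrightarrow> exec B c\<^sub>2 s' t\<^sub>2 s'' \<Longrightarrow> exec B (Seq c\<^sub>1 c\<^sub>2) s (t\<^sub>1 + t\<^sub>2) s''"
| IfTrue: "holds b (fst s) \<Longrightarrow> exec B c\<^sub>1 s t s' \<Longrightarrow> exec B (If b c\<^sub>1 c\<^sub>2) s (1 + t) s'"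
| IfFalse: "\<not> holds b (fst s) \<Longrightarrow> exec B c\<^sub>2 s t s' \<Longrightarrow> exec B (If b c\<^sub>1 c\<^sub>2) s (1 + t) s'"
| WhileFalse: "\<not> holds b (fst s) \<Longrightarrow> exec B (While b c) s 1 s"
| WhileTrue: "holds b (fst s) \<Longrightarrow> exec B c s t\<^sub>1 s' \<Longrightarrow> exec B (While b c) s' t\<^sub>2 s'' \<Longrightarrow>
    exec B (While b c) s (1 + t\<^sub>1 + t\<^sub>2) s''"

lemma exec_deterministic:
  "exec B c s t s' \<Longrightarrow> exec B c s u s'' \<Longrightarrow> t = u \<and> s' = s''"
proof (induction arbitrary: u s'' rule: exec.induct)
  case (Seq c\<^sub>1 s t\<^sub>1 s' c\<^sub>2 t\<^sub>2 s1)
  from Seq.prems show ?case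
    by cases (use Seq.IH in blast)
next
  case (IfTrue b s c\<^sub>1 t s' c\<^sub>2)
  from IfTrue.prems show ?case
    by cases (use IfTrue in blast)+
next
  case (IfFalse b s c\<^sub>2 t s' c\<^sub>1)
  from IfFalse.prems show ?case
    by cases (use IfFalse in blast)+
next
  case (WhileTrue b s c t\<^sub>1 s' t\<^sub>2 s1)
  from WhileTrue.prems show ?case
    by cases (use WhileTrue in blast)+
qed (auto elim: exec.cases)

section \<open>Input\<close>

text \<open>Adjacency lists of a graph on \<open>{..<n}\<close>; the order within a list is arbitrary.\<close>

definition adjacency_lists :: "nat \<Rightarrow> nat set set \<Rightarrow> (nat \<Rightarrow> nat list) \<Rightarrow> bool" where
  "adjacency_lists n E adj \<longleftrightarrow> (\<forall>u<n. distinct (adj u) \<and> set (adj u) = nbh E u)"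

text \<open>
  The adjacency lists occupy consecutive memory cells from address \<open>n + 1\<close> on, in the order
  of the vertices.  For \<open>u < n\<close>, the list of \<open>u\<close> consists of the cells from the address
  stored in cell \<open>u\<close> up to, but excluding, the address stored in cell \<open>u + 1\<close>.
\<close>

definition input_cells :: "nat \<Rightarrow> (nat \<Rightarrow> nat list) \<Rightarrow> nat list" where
  "input_cells n adj =
     map (\<lambda>u. n + 1 + (\<Sum>w<u. length (adj w))) [0..<n + 1] @ concat (map adj [0..<n])"

text \<open>Register 0 holds \<open>n\<close>, register 1 the queried vertex; all else is initially 0.\<close>

definition input_state :: "nat \<Rightarrow> (nat \<Rightarrow> nat list) \<Rightarrow> nat \<Rightarrow> state" where
  "input_state n adj v =
     ((\<lambda>_. 0)(0 := n, 1 := v),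
      (\<lambda>a. if a < length (input_cells n adj) then input_cells n adj ! a else 0))"

text \<open>The answer is read off register 0.\<close>

definition answer :: "state \<Rightarrow> nat" where
  "answer s = fst s 0"

end

theory Submission
  imports Defs
begin

text \<open>
  The vertex \<open>v\<close> fails to be shedding iff some independent set outside \<open>N[v]\<close> dominates
  \<open>N(v)\<close>.  Such a set is sought by unit propagation.  If a vertex of \<open>N(v)\<close> has no
  available neighbour left, there is none; if it has exactly one, \<open>x\<close>, then \<open>x\<close> is
  forced, which settles all vertices of \<open>N(v)\<close> adjacent to \<open>x\<close> and makes the other
  neighbours of \<open>x\<close> unavailable.  If every remaining vertex of \<open>N(v)\<close> has at least two
  available neighbours, a solution exists: without cycles of lengths 4 and 6, a chosen vertex
  takes at most one available neighbour away from the remaining vertices, so a greedy choice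
  never gets stuck.  There are at most \<open>n\<close> propagation steps, each of time \<open>O(n + m)\<close>.
\<close>

section \<open>Independent sets dominating the neighbourhood\<close>

text \<open>The vertices \<open>U\<close> to be dominated and the vertices \<open>A\<close> that may
  be chosen are separate parameters, because each propagation step shrinks both.\<close>

definition indep_dominable :: "'a set set \<Rightarrow> 'a set \<Rightarrow> 'a set \<Rightarrow> bool" where
  "indep_dominable E U A \<longleftrightarrow> (\<exists>S\<subseteq>A. independent E S \<and> (\<forall>u\<in>U. nbh E u \<inter> S \<noteq> {}))"

lemma nbh_sym: "x \<in> nbh E y \<longleftrightarrow> y \<in> nbh E x"
  by (simp add: nbh_def insert_commute)

lemma nbh_subset: "simple_graph V E \<Longrightarrow> nbh E x \<subseteq> V"
  by (auto simp: simple_graph_def nbh_def)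

lemma nbh_irrefl: "simple_graph V E \<Longrightarrow> x \<notin> nbh E x"
  by (auto simp: simple_graph_def nbh_def)

lemma independent_insert:
  assumes "simple_graph V E"
  shows "independent E (insert x S) \<longleftrightarrow> independent E S \<and> nbh E x \<inter> S = {}"
  using nbh_irrefl[OF assms, of x]
  by (auto simp: independent_def nbh_def insert_commute)

text \<open>Adding a neighbour \<open>u\<close> of \<open>v\<close> to an independent
  \<open>S\<close> destroys independence iff \<open>S\<close> meets \<open>nbh E u\<close>. So a set
  refuting shedding is an independent set outside the closed neighbourhood that meets
  \<open>nbh E u\<close> for every such \<open>u\<close>.\<close>

lemma shedding_iff_not_indep_dominable:
  assumes "simple_graph V E"
  shows "shedding V E v \<longleftrightarrow> \<not> indep_dominable E (nbh E v) (V - closed_nbh E v)"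
  unfolding shedding_def indep_dominable_def
  by (auto simp: independent_insert[OF assms])

lemma not_indep_dominable:
  assumes "u \<in> U" "nbh E u \<inter> A = {}"
  shows "\<not> indep_dominable E U A"
  using assms by (auto simp: indep_dominable_def)

text \<open>A solution of the smaller instance avoids \<open>nbh E x\<close>, so \<open>x\<close>
  can be added to it, and \<open>x\<close> dominates exactly the vertices removed from
  \<open>U\<close>.\<close>

lemma indep_dominable_extend:
  assumes "simple_graph V E" "x \<in> A"
    and "indep_dominable E (U - nbh E x) (A - nbh E x)"
  shows "indep_dominable E U A"
proof -
  obtain S where S: "S \<subseteq> A - nbh E x" "independent E S" "\<forall>u\<in>U - nbh E x. nbh E u \<inter> S \<noteq> {}"
    using assms(3) by (auto simp: indep_dominable_def)
  have "independent E (insert x S)"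
    using S by (auto simp: independent_insert[OF assms(1)])
  moreover have "nbh E u \<inter> insert x S \<noteq> {}" if "u \<in> U" for u
    using S(3) that nbh_sym[of u E x] by blast
  ultimately show ?thesis
    unfolding indep_dominable_def using S(1) assms(2) by (intro exI[of _ "insert x S"]) auto
qed

text \<open>Only \<open>x\<close> can dominate \<open>u\<close>, so every solution contains
  \<open>x\<close> and avoids \<open>nbh E x\<close>. It then solves the smaller instance unchanged,
  since \<open>x\<close> itself stays in \<open>A - nbh E x\<close>.\<close>

lemma indep_dominable_forced:
  assumes "simple_graph V E" "u \<in> U" "nbh E u \<inter> A = {x}"
  shows "indep_dominable E U A \<longleftrightarrow> indep_dominable E (U - nbh E x) (A - nbh E x)"
proof
  assume "indep_dominable E U A"
  then obtain S where S: "S \<subseteq> A" "independent E S" "\<forall>u\<in>U. nbh E u \<inter> S \<noteq> {}"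
    by (auto simp: indep_dominable_def)
  have "x \<in> S"
    using S(1) S(3)[rule_format, OF assms(2)] assms(3) by auto
  then have "nbh E x \<inter> S = {}"
    using S(2) by (auto simp: independent_def nbh_def)
  then show "indep_dominable E (U - nbh E x) (A - nbh E x)"
    using S unfolding indep_dominable_def by (intro exI[of _ S]) auto
qed (use indep_dominable_extend[OF assms(1)] assms(3) in blast)

section \<open>Consequences of excluding cycles of lengths 4 and 6\<close>

lemma has_cycle_4I:
  assumes "distinct [a, b, c, d]" "b \<in> nbh E a" "c \<in> nbh E b" "d \<in> nbh E c" "a \<in> nbh E d"
  shows "has_cycle E 4"
proof -
  have "{[a, b, c, d] ! i, [a, b, c, d] ! (Suc i mod 4)} \<in> E" if "i < 4" for i
  proof -
    have "i \<in> {0, 1, 2, 3}"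
      using that by auto
    then show ?thesis
      using assms(2-) by (auto simp: nbh_def)
  qed
  then show ?thesis
    unfolding has_cycle_def using assms(1) by (intro conjI exI[of _ "[a, b, c, d]"]) simp_all
qed

lemma has_cycle_6I:
  assumes "distinct [a, b, c, d, e, f]"
    "b \<in> nbh E a" "c \<in> nbh E b" "d \<in> nbh E c" "e \<in> nbh E d" "f \<in> nbh E e" "a \<in> nbh E f"
  shows "has_cycle E 6"
proof -
  have "{[a, b, c, d, e, f] ! i, [a, b, c, d, e, f] ! (Suc i mod 6)} \<in> E" if "i < 6" for i
  proof -
    have "i \<in> {0, 1, 2, 3, 4, 5}"
      using that by auto
    then show ?thesis
      using assms(2-) by (auto simp: nbh_def)
  qed
  then show ?thesis
    unfolding has_cycle_def using assms(1) by (intro conjI exI[of _ "[a, b, c, d, e, f]"]) simp_all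
qed

text \<open>Two different paths \<open>v\<close>, \<open>w\<close>, \<open>y\<close>,
  \<open>x\<close> and \<open>v\<close>, \<open>w'\<close>, \<open>y'\<close>, \<open>x\<close>
  close up to a cycle: of length 4 if they share one inner vertex, of length 6 if they share
  none.\<close>

lemma unique_path_to_nbh:
  assumes G: "simple_graph V E" "\<not> has_cycle E 4" "\<not> has_cycle E 6"
    and x: "x \<notin> closed_nbh E v"
    and w: "w \<in> nbh E v" "w' \<in> nbh E v"
    and y: "y \<in> nbh E w \<inter> nbh E x" "y \<notin> closed_nbh E v"
    and y': "y' \<in> nbh E w' \<inter> nbh E x" "y' \<notin> closed_nbh E v"
  shows "w = w' \<and> y = y'"
proof (rule ccontr)
  have ne: "x \<noteq> y" "x \<noteq> y'" "v \<noteq> w" "v \<noteq> w'"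
    using nbh_irrefl[OF G(1)] y y' w by auto
  \<comment> \<open>The inner vertices of the paths lie on different levels: \<open>w\<close>,
    \<open>w'\<close> inside the neighbourhood of \<open>v\<close>, and \<open>y\<close>,
    \<open>y'\<close>, \<open>x\<close> outside its closure. This gives the distinctness that the
    cycles require.\<close>
  have ne': "x \<notin> {v, w, w'}" "y \<notin> {v, w, w'}" "y' \<notin> {v, w, w'}"
    using x y y' w by (auto simp: closed_nbh_def)
  have sym: "v \<in> nbh E w" "v \<in> nbh E w'" "w \<in> nbh E y" "w' \<in> nbh E y'" "x \<in> nbh E y" "x \<in> nbh E y'"
    using w y y' by (auto simp: nbh_def insert_commute)
  assume "\<not> (w = w' \<and> y = y')"
  then consider "w \<noteq> w'" "y = y'" | "w = w'" "y \<noteq> y'" | "w \<noteq> w'" "y \<noteq> y'"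
    by blast
  then show False
  proof cases
    case 1
    then have "has_cycle E 4"
      using ne ne' w y y' sym by (intro has_cycle_4I[of v w y w']) auto
    with G show False by blast
  next
    case 2
    then have "has_cycle E 4"
      using ne ne' w y y' sym by (intro has_cycle_4I[of w y x y']) auto
    with G show False by blast
  next
    case 3
    then have "has_cycle E 6"
      using ne ne' w y y' sym by (intro has_cycle_6I[of v w y x y' w']) auto
    with G show False by blast
  qed
qed

text \<open>Greedy choice: serving a vertex with the fewest options takes at most one option away
  from at most one other vertex, so at most one vertex ever has fewer than two options.\<close>

lemma indep_dominable_greedy:
  assumes G: "simple_graph V E" "\<not> has_cycle E 4" "\<not> has_cycle E 6"
    and U: "finite U" "U \<subseteq> nbh E v"
    and A: "A \<subseteq> V - closed_nbh E v"
    and one: "\<And>u. u \<in> U \<Longrightarrow> nbh E u \<inter> A \<noteq> {}"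
    and two: "\<And>u w. u \<in> U \<Longrightarrow> w \<in> U \<Longrightarrow> card (nbh E u \<inter> A) < 2 \<Longrightarrow> card (nbh E w \<inter> A) < 2 \<Longrightarrow> u = w"
  shows "indep_dominable E U A"
  using U A one two
proof (induction "card U" arbitrary: U A rule: less_induct)
  case less
  show ?case
  proof (cases "U = {}")
    case True
    then show ?thesis
      by (auto simp: indep_dominable_def independent_def)
  next
    case False
    have fin: "finite (nbh E u)" for u
      using finite_subset[OF nbh_subset[OF G(1)]] G(1) by (simp add: simple_graph_def)
    \<comment> \<open>Take the vertex with fewer than two choices if there is one, and any vertex
      otherwise.\<close>
    obtain u where u: "u \<in> U" "\<And>w. w \<in> U \<Longrightarrow> w \<noteq> u \<Longrightarrow> 2 \<le> card (nbh E w \<inter> A)"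
      using False less.prems(5) by (metis not_less all_not_in_conv)
    obtain x where x: "x \<in> nbh E u" "x \<in> A"
      using less.prems(4)[OF u(1)] by blast
    let ?U = "U - nbh E x" and ?A = "A - nbh E x"
    have u': "u \<notin> ?U"
      using x nbh_sym by fastforce
    have xv: "x \<notin> closed_nbh E v"
      using x less.prems(3) by blast
    \<comment> \<open>Choosing \<open>x\<close> costs the remaining vertices, taken together, at
      most one pair of a vertex \<open>w\<close> and an option \<open>y\<close>.\<close>
    have drop: "w = w' \<and> y = y'"
      if "w \<in> ?U" "w' \<in> ?U" "y \<in> nbh E w \<inter> A \<inter> nbh E x" "y' \<in> nbh E w' \<inter> A \<inter> nbh E x"
      for w w' y y'
      using that less.prems(2,3) by (intro unique_path_to_nbh[OF G xv]) auto
    have eq: "nbh E w \<inter> ?A = nbh E w \<inter> A - (nbh E w \<inter> A \<inter> nbh E x)" for w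
      by blast
    have le1: "card (nbh E w \<inter> A \<inter> nbh E x) \<le> 1" if "w \<in> ?U" for w
      using drop[OF that that] fin by (auto simp: card_le_Suc0_iff_eq)
    have one: "nbh E w \<inter> ?A \<noteq> {}" if w: "w \<in> ?U" for w
    proof -
      have "2 \<le> card (nbh E w \<inter> A)"
        using u(2) w u' by blast
      then have "card (nbh E w \<inter> ?A) \<ge> 1"
        unfolding eq using le1[OF w] fin by (subst card_Diff_subset) auto
      then show ?thesis
        by auto
    qed
    \<comment> \<open>All remaining vertices had two options before, so one that now has fewer must
      have lost an option. By \<open>drop\<close> this happens to at most one of them, which
      restores the invariant \<open>two\<close>.\<close>
    have touched: "nbh E w \<inter> A \<inter> nbh E x \<noteq> {}"
      if w: "w \<in> ?U" and c: "card (nbh E w \<inter> ?A) < 2" for w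
    proof
      assume "nbh E w \<inter> A \<inter> nbh E x = {}"
      then have "card (nbh E w \<inter> A) < 2"
        using c unfolding eq by simp
      moreover have "w \<in> U" "w \<noteq> u"
        using w u' by blast+
      ultimately show False
        using u(2)[of w] by simp
    qed
    have two: "w = w'" if "w \<in> ?U" "w' \<in> ?U"
      "card (nbh E w \<inter> ?A) < 2" "card (nbh E w' \<inter> ?A) < 2" for w w'
      using touched[of w] touched[of w'] drop[of w w'] that by blast
    have "card ?U < card U"
      using less.prems(1) u u' by (intro psubset_card_mono) auto
    then have "indep_dominable E ?U ?A"
      using less.prems one two by (intro less.hyps) auto
    then show ?thesis
      using indep_dominable_extend[OF G(1) x(2)] by blast
  qed
qed

text \<open>Double counting of incidences, with the neighbours of \<open>u\<close> in bijection with
  the edges at \<open>u\<close>. It turns the total length of the adjacency lists into twice the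
  number of edges.\<close>

lemma sum_card_nbh:
  assumes "simple_graph V E"
  shows "(\<Sum>u\<in>V. card (nbh E u)) = 2 * card E"
proof -
  have V: "finite V" and E: "\<And>e. e \<in> E \<Longrightarrow> e \<subseteq> V \<and> card e = 2"
    using assms by (auto simp: simple_graph_def)
  have finE: "finite E"
    using V E by (meson Pow_iff finite_Pow_iff rev_finite_subset subsetI)
  have "card (nbh E u) = card {e \<in> E. u \<in> e}" for u
  proof (rule bij_betw_same_card)
    have "\<exists>w. e = {u, w}" if "e \<in> E" "u \<in> e" for e
      using E[OF that(1)] that(2) by (auto simp: card_2_iff)
    then show "bij_betw (\<lambda>w. {u, w}) (nbh E u) {e \<in> E. u \<in> e}"
      by (auto simp: bij_betw_def inj_on_def nbh_def doubleton_eq_iff)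
  qed
  then have "(\<Sum>u\<in>V. card (nbh E u)) = (\<Sum>u\<in>V. card {e \<in> E. u \<in> e})"
    by simp
  also have "\<dots> = (\<Sum>e\<in>E. card {u \<in> V. u \<in> e})"
    using V finE by (intro sum_multicount_gen) auto
  also have "\<dots> = (\<Sum>e\<in>E. 2)"
    using E by (intro sum.cong refl) (metis Collect_conj_eq Collect_mem_eq inf.absorb2)
  finally show ?thesis
    by simp
qed

section \<open>Total correctness with time\<close>

text \<open>A weakest precondition for total correctness. The time is an argument of the
  postcondition, so cost and effect are proved together, and the equivalences that follow let the
  simplifier execute straight-line code.\<close>

definition runs :: "nat \<Rightarrow> com \<Rightarrow> state \<Rightarrow> (nat \<Rightarrow> state \<Rightarrow> bool) \<Rightarrow> bool" where
  "runs B c s Q \<longleftrightarrow> (\<exists>t s'. exec B c s t s' \<and> Q t s')"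

lemma runs_mono:
  assumes "runs B c s Q" "\<And>t s'. Q t s' \<Longrightarrow> Q' t s'"
  shows "runs B c s Q'"
  using assms unfolding runs_def by blast

lemma runs_Skip [simp]:
  "runs B Skip s Q \<longleftrightarrow> Q 1 s"
  by (auto simp: runs_def exec.simps[of B "Skip"] simp del: split_paired_Ex)

lemma runs_Imm [simp]:
  "runs B (Imm r k) (R, M) Q \<longleftrightarrow> k \<le> B \<and> Q 1 (R(r := k), M)"
  by (auto simp: runs_def exec.simps[of B "Imm r k"] simp del: split_paired_Ex)

lemma runs_Copy [simp]:
  "runs B (Copy r q) (R, M) Q \<longleftrightarrow> Q 1 (R(r := R q), M)"
  by (auto simp: runs_def exec.simps[of B "Copy r q"] simp del: split_paired_Ex)

lemma runs_Add [simp]: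
  "runs B (Add r p q) (R, M) Q \<longleftrightarrow> R p + R q \<le> B \<and> Q 1 (R(r := R p + R q), M)"
  by (auto simp: runs_def exec.simps[of B "Add r p q"] simp del: split_paired_Ex)

lemma runs_Load [simp]:
  "runs B (Load r q) (R, M) Q \<longleftrightarrow> Q 1 (R(r := M (R q)), M)"
  by (auto simp: runs_def exec.simps[of B "Load r q"] simp del: split_paired_Ex)

lemma runs_Store [simp]:
  "runs B (Store r q) (R, M) Q \<longleftrightarrow> Q 1 (R, M(R r := R q))"
  by (auto simp: runs_def exec.simps[of B "Store r q"] simp del: split_paired_Ex)

lemma runs_Seq [simp]:
  "runs B (Seq c c') s Q \<longleftrightarrow> runs B c s (\<lambda>t s'. runs B c' s' (\<lambda>t' s''. Q (t + t') s''))"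
proof
  assume "runs B (Seq c c') s Q"
  then obtain t s'' where *: "exec B (Seq c c') s t s''" "Q t s''"
    unfolding runs_def by blast
  from *(1) show "runs B c s (\<lambda>t s'. runs B c' s' (\<lambda>t' s''. Q (t + t') s''))"
    by cases (use *(2) in \<open>unfold runs_def, blast\<close>)
qed (use exec.Seq in \<open>unfold runs_def, metis\<close>)

lemma runs_If [simp]:
  "runs B (If b c c') s Q \<longleftrightarrow>
     (if holds b (fst s) then runs B c s (\<lambda>t. Q (1 + t)) else runs B c' s (\<lambda>t. Q (1 + t)))"
  by (auto simp: runs_def exec.simps[of B "If b c c'"] simp del: split_paired_Ex)

text \<open>A single unfolding of the loop. It is not a simp rule because the loop occurs again on
  the right.\<close>

lemma runs_While:
  "runs B (While b c) s Q \<longleftrightarrow>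
     (if holds b (fst s)
      then runs B c s (\<lambda>t s'. runs B (While b c) s' (\<lambda>t' s''. Q (1 + t + t') s''))
      else Q 1 s)" (is "_ \<longleftrightarrow> ?R")
proof
  assume "runs B (While b c) s Q"
  then obtain t s'' where *: "exec B (While b c) s t s''" "Q t s''"
    unfolding runs_def by blast
  from *(1) show ?R
  proof cases
    case WhileFalse
    then show ?thesis
      using *(2) by simp
  next
    case (WhileTrue t1 s' t2)
    then show ?thesis
      using *(2) unfolding runs_def if_P[OF WhileTrue(2)] by blast
  qed
next
  assume ?R
  then show "runs B (While b c) s Q"
    unfolding runs_def using exec.WhileTrue exec.WhileFalse by metis
qed

section \<open>The program\<close>

text \<open>Register 2 holds 1, register 4 holds 2, register 15 holds 0, and register 3 holds the first
  address behind the input, where the array of marks begins.  Mark 1 stands for a neighbour of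
  \<open>v\<close> that is still to be dominated, mark 0 for a vertex that may still be chosen, and mark 2
  for all other vertices.\<close>

definition fill_loop :: "nat \<Rightarrow> com" where
  "fill_loop w = While (Less 5 6) (Seq (Load 7 5) (Seq (Add 7 7 3) (Seq (Store 7 w) (Add 5 5 2))))"

text \<open>Register \<open>q\<close> holds a vertex, and the marks of its neighbours become the
  value of register \<open>w\<close>. Registers 5 and 6 delimit the unread part of the list.\<close>

definition fill :: "nat \<Rightarrow> nat \<Rightarrow> com" where
  "fill q w = Seq (Load 5 q) (Seq (Add 6 q 2) (Seq (Load 6 6) (fill_loop w)))"

text \<open>Register 8 counts the available neighbours, and register 10 remembers the latest one; if
  the count is 1, this is the forced vertex.\<close>

definition count_loop :: com where
  "count_loop = While (Less 5 6)
     (Seq (Load 7 5) (Seq (Add 9 7 3) (Seq (Load 9 9)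
       (Seq (If (Eq 9 15) (Seq (Add 8 8 2) (Copy 10 7)) Skip) (Add 5 5 2)))))"

definition count :: com where
  "count = Seq (Load 5 12) (Seq (Add 6 12 2) (Seq (Load 6 6) (Seq (Imm 8 0) count_loop)))"

definition scan_body :: com where
  "scan_body = Seq (Add 9 12 3) (Seq (Load 9 9)
     (Seq (If (Eq 9 2) (Seq count (If (Less 8 11) (Seq (Copy 11 8) (Copy 13 10)) Skip)) Skip)
       (Add 12 12 2)))"

text \<open>Register 11 computes the least number of choices of a pending vertex, capped at the
  initial value 2. The outcomes 0, 1 and 2 mean failure, a forced vertex in register 13, and success
  by greedy choice.\<close>

definition scan :: com where
  "scan = Seq (Copy 11 4) (Seq (Imm 12 0) (While (Less 12 0) scan_body))"

text \<open>Register 2 holds 1, so the loop runs while some vertex is forced. Writing mark 2 on all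
  neighbours of the forced vertex both settles the pending ones and discards the available
  ones.\<close>

definition propagate :: com where
  "propagate = While (Eq 11 2) (Seq (fill 13 4) scan)"

text \<open>Cell \<open>n\<close> stores the end of the last list, which is the base address of the
  marks. Vertices not written to keep the initial mark 0 and so start as available.\<close>

definition setup_marks :: com where
  "setup_marks = Seq (Imm 2 1) (Seq (Load 3 0) (Seq (Imm 4 2)
     (Seq (Add 5 1 3) (Seq (Store 5 4) (fill 1 2)))))"

definition shedding_program :: com where
  "shedding_program = Seq setup_marks (Seq scan (Seq propagate (If (Eq 11 15) (Imm 0 1) (Imm 0 0))))"

section \<open>Memory layout of the input and the marks\<close>

lemma nth_concat_map_upt:
  assumes "u < n" "i < length (f u)"
  shows "concat (map f [0..<n]) ! ((\<Sum>w<u. length (f w)) + i) = f u ! i"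
  using assms
proof (induction n)
  case (Suc n)
  have len: "length (concat (map f [0..<m])) = (\<Sum>w<m. length (f w))" for m
    by (induction m) auto
  show ?case
  proof (cases "u = n")
    case True
    then show ?thesis
      using Suc.prems by (simp add: nth_append len)
  next
    case False
    then have "u < n"
      using Suc.prems by simp
    then have "(\<Sum>w<u. length (f w)) + length (f u) \<le> (\<Sum>w<n. length (f w))"
      using sum_mono2[of "{..<n}" "{..<Suc u}" "\<lambda>w. length (f w)"] by auto
    then show ?thesis
      using Suc \<open>u < n\<close> by (simp add: nth_append len)
  qed
qed simp

text \<open>The bound on \<open>B\<close> covers all numbers produced: the constants up to 2, the
  addresses up to the last mark cell, and the counters.\<close>

locale ram_input =
  fixes n :: nat and E :: "nat set set" and adj :: "nat \<Rightarrow> nat list" and B :: nat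
  assumes graph: "simple_graph {..<n} E"
    and adj: "adjacency_lists n E adj"
    and B: "2 \<le> B" "n + 1 + (\<Sum>w<n. length (adj w)) + n \<le> B"
begin

definition off :: "nat \<Rightarrow> nat" where
  "off u = n + 1 + (\<Sum>w<u. length (adj w))"

text \<open>Every memory occurring in a run has this form, since stores only hit mark cells. A store
  thus becomes an update of the function \<open>mk\<close>.\<close>

definition mem :: "(nat \<Rightarrow> nat) \<Rightarrow> nat \<Rightarrow> nat" where
  "mem mk a = (if a < off n then input_cells n adj ! a else mk (a - off n))"

lemma set_adj: "u < n \<Longrightarrow> set (adj u) = nbh E u"
  and distinct_adj: "u < n \<Longrightarrow> distinct (adj u)"
  using adj by (auto simp: adjacency_lists_def)

lemma set_adj_subset: "u < n \<Longrightarrow> set (adj u) \<subseteq> {..<n}"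
  using set_adj nbh_subset[OF graph] by blast

lemma length_input_cells: "length (input_cells n adj) = off n"
proof -
  have "length (concat (map adj [0..<m])) = (\<Sum>w<m. length (adj w))" for m
    by (induction m) auto
  then show ?thesis
    by (simp add: input_cells_def off_def)
qed

lemma off_Suc: "off (Suc u) = off u + length (adj u)"
  by (simp add: off_def)

lemma off_mono: "u \<le> u' \<Longrightarrow> off u \<le> off u'"
  by (auto simp: off_def intro!: sum_mono2)

lemma off_le_B: "off n + n \<le> B"
  using B by (simp add: off_def)

lemma mem_off: "u \<le> n \<Longrightarrow> mem mk u = off u"
proof -
  assume u: "u \<le> n"
  then have "[0..<n + 1] ! u = u" "u < off n"
    by (simp_all add: off_def nth_append del: upt_Suc)
  then show ?thesis
    using u by (simp add: mem_def input_cells_def nth_append off_def del: upt_Suc)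
qed

lemma mem_adj:
  assumes "u < n" "i < length (adj u)"
  shows "mem mk (off u + i) = adj u ! i"
proof -
  have "off u + i < off n"
    using off_mono[of "Suc u" n] assms by (simp add: off_Suc)
  then show ?thesis
    using nth_concat_map_upt[of u n i adj] assms
    by (simp add: mem_def input_cells_def nth_append off_def del: upt_Suc)
qed

lemma mem_mark: "mem mk (x + off n) = mk x"
  by (simp add: mem_def)

lemma mem_update: "(mem mk)(x + off n := c) = mem (mk(x := c))"
  by (auto simp: mem_def fun_eq_iff)

lemma input_state_eq: "input_state n adj v = ((\<lambda>_. 0)(0 := n, 1 := v), mem (\<lambda>_. 0))"
  by (auto simp: input_state_def mem_def length_input_cells fun_eq_iff)

section \<open>Loops over adjacency lists\<close>

text \<open>Induction on the unread part \<open>ys\<close>, which starts at address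
  \<open>a\<close>. The assumption on its cells is quantified over \<open>mk\<close> because marks
  change during the reading. A round costs one test and four instructions; the final test adds
  1.\<close>

lemma runs_fill_loop:
  assumes "R 2 = 1" "R 3 = off n" "R 5 = a" "R 6 = a + length ys" "a + length ys \<le> off n"
    and "\<And>i mk. i < length ys \<Longrightarrow> mem mk (a + i) = ys ! i" "set ys \<subseteq> {..<n}" "w \<notin> {5, 6, 7}"
  shows "runs B (fill_loop w) (R, mem mk) (\<lambda>t (R', M').
    t = 1 + 5 * length ys \<and> (\<forall>r. r \<notin> {5, 6, 7} \<longrightarrow> R' r = R r) \<and>
    M' = mem (\<lambda>z. if z \<in> set ys then R w else mk z))"
  using assms
proof (induction ys arbitrary: a R mk)
  case Nil
  then show ?case
    unfolding fill_loop_def by (subst runs_While) simp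
next
  case (Cons y ys)
  let ?R = "R(7 := y + off n, 5 := a + 1)"
  have y: "mem mk a = y" "y < n"
    using Cons.prems(6)[of 0] Cons.prems(7) by auto
  have "runs B (fill_loop w) (?R, mem (mk(y := R w))) (\<lambda>t (R', M').
    t = 1 + 5 * length ys \<and> (\<forall>r. r \<notin> {5, 6, 7} \<longrightarrow> R' r = ?R r) \<and>
    M' = mem (\<lambda>z. if z \<in> set ys then ?R w else (mk(y := R w)) z))"
    using Cons.prems(6)[of "Suc _"] Cons.prems by (intro Cons.IH) auto
  then have "runs B (fill_loop w) (?R, mem (mk(y := R w))) (\<lambda>t (R', M').
    t + 5 = 1 + 5 * length (y # ys) \<and> (\<forall>r. r \<notin> {5, 6, 7} \<longrightarrow> R' r = R r) \<and>
    M' = mem (\<lambda>z. if z \<in> set (y # ys) then R w else mk z))"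
    by (rule runs_mono) (use Cons.prems(8) in \<open>auto intro!: arg_cong[of _ _ mem]\<close>)
  then show ?case
    using y Cons.prems off_le_B unfolding fill_loop_def
    by (subst runs_While) (simp add: mem_update add.commute)
qed

lemma runs_fill:
  assumes "R 2 = 1" "R 3 = off n" "R q < n" "q \<notin> {5, 6, 7}" "w \<notin> {5, 6, 7}"
  shows "runs B (fill q w) (R, mem mk) (\<lambda>t (R', M').
    t = 4 + 5 * length (adj (R q)) \<and> (\<forall>r. r \<notin> {5, 6, 7} \<longrightarrow> R' r = R r) \<and>
    M' = mem (\<lambda>z. if z \<in> nbh E (R q) then R w else mk z))"
proof -
  let ?R = "R(5 := off (R q), 6 := off (Suc (R q)))"
  have "runs B (fill_loop w) (?R, mem mk) (\<lambda>t (R', M').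
    t = 1 + 5 * length (adj (R q)) \<and> (\<forall>r. r \<notin> {5, 6, 7} \<longrightarrow> R' r = ?R r) \<and>
    M' = mem (\<lambda>z. if z \<in> set (adj (R q)) then ?R w else mk z))"
    using assms off_mono[of "Suc (R q)" n] set_adj_subset[of "R q"]
    by (intro runs_fill_loop[of _ "off (R q)"]) (auto simp: off_Suc mem_adj)
  then have "runs B (fill_loop w) (?R, mem mk) (\<lambda>t (R', M').
    t + 3 = 4 + 5 * length (adj (R q)) \<and> (\<forall>r. r \<notin> {5, 6, 7} \<longrightarrow> R' r = R r) \<and>
    M' = mem (\<lambda>z. if z \<in> nbh E (R q) then R w else mk z))"
    by (rule runs_mono) (use assms set_adj in \<open>auto cong: if_cong\<close>)
  then show ?thesis
    using assms off_le_B by (simp add: fill_def mem_off add.commute)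
qed

text \<open>A round costs at most 8, attained when an available neighbour is found. The old value of
  register 10 heads the list under \<open>last\<close> as the default for the case that none is
  found.\<close>

lemma runs_count_loop:
  assumes "R 2 = 1" "R 3 = off n" "R 15 = 0" "R 5 = a" "R 6 = a + length ys"
    and "a + length ys \<le> off n" "R 8 + length ys \<le> B"
    and "\<And>i. i < length ys \<Longrightarrow> mem mk (a + i) = ys ! i" "set ys \<subseteq> {..<n}"
  shows "runs B count_loop (R, mem mk) (\<lambda>t (R', M').
    t \<le> 1 + 8 * length ys \<and> (\<forall>r. r \<notin> {5, 6, 7, 8, 9, 10} \<longrightarrow> R' r = R r) \<and> M' = mem mk \<and>
    R' 8 = R 8 + length (filter (\<lambda>y. mk y = 0) ys) \<and>
    R' 10 = last (R 10 # filter (\<lambda>y. mk y = 0) ys))"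
  using assms
proof (induction ys arbitrary: a R)
  case Nil
  then show ?case
    unfolding count_loop_def by (subst runs_While) simp
next
  case (Cons y ys)
  have y: "mem mk a = y" "y < n"
    using Cons.prems(8)[of 0] Cons.prems(9) by auto
  define R1 where "R1 = (if mk y = 0 then R(7 := y, 9 := mk y, 8 := Suc (R 8), 10 := y, 5 := Suc a)
    else R(7 := y, 9 := mk y, 5 := Suc a))"
  have "runs B count_loop (R1, mem mk) (\<lambda>t (R', M').
    t \<le> 1 + 8 * length ys \<and> (\<forall>r. r \<notin> {5, 6, 7, 8, 9, 10} \<longrightarrow> R' r = R1 r) \<and> M' = mem mk \<and>
    R' 8 = R1 8 + length (filter (\<lambda>y. mk y = 0) ys) \<and>
    R' 10 = last (R1 10 # filter (\<lambda>y. mk y = 0) ys))"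
    using Cons.prems(8)[of "Suc _"] Cons.prems by (intro Cons.IH[of _ "Suc a"]) (auto simp: R1_def)
  then have *: "runs B count_loop (R1, mem mk) (\<lambda>t (R', M').
    t + 8 \<le> 1 + 8 * length (y # ys) \<and>
    (\<forall>r. r \<notin> {5, 6, 7, 8, 9, 10} \<longrightarrow> R' r = R r) \<and> M' = mem mk \<and>
    R' 8 = R 8 + length (filter (\<lambda>y. mk y = 0) (y # ys)) \<and>
    R' 10 = last (R 10 # filter (\<lambda>y. mk y = 0) (y # ys)))"
    by (rule runs_mono) (auto simp: R1_def)
  have a: "a < R 6" "mem mk (off n + y) = mk y"
    using Cons.prems by (simp_all add: mem_mark add.commute[of "off n"])
  show ?case
  proof (cases "mk y = 0")
    case True
    then have R1: "R1 = R(7 := y, 9 := 0, 8 := Suc (R 8), 10 := y, 5 := Suc a)"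
      by (simp add: R1_def)
    show ?thesis
      unfolding count_loop_def using y Cons.prems(1-4,6,7) off_le_B True a
      by (subst runs_While) (simp add: add.commute del: last.simps add: last_ConsR flip: R1 count_loop_def,
        rule runs_mono[OF *], auto simp: True)
  next
    case False
    then have R1: "R1 = R(7 := y, 9 := mk y, 5 := Suc a)"
      by (simp add: R1_def)
    show ?thesis
      unfolding count_loop_def using y Cons.prems(1-4,6,7) off_le_B False a
      by (subst runs_While) (simp add: add.commute del: last.simps add: last_ConsR flip: R1 count_loop_def,
        rule runs_mono[OF *], auto simp: False)
  qed
qed

section \<open>Scanning the pending vertices\<close>

text \<open>The sets \<open>pending mk\<close> and \<open>avail mk\<close> are the instance of
  \<open>indep_dominable\<close> encoded by the marks.\<close>

definition pending :: "(nat \<Rightarrow> nat) \<Rightarrow> nat set" where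
  "pending mk = {u. u < n \<and> mk u = 1}"

definition avail :: "(nat \<Rightarrow> nat) \<Rightarrow> nat set" where
  "avail mk = {u. u < n \<and> mk u = 0}"

definition choices :: "(nat \<Rightarrow> nat) \<Rightarrow> nat \<Rightarrow> nat set" where
  "choices mk u = nbh E u \<inter> avail mk"

lemma finite_choices: "finite (choices mk u)"
  by (simp add: choices_def avail_def)

lemma runs_count:
  assumes "R 2 = 1" "R 3 = off n" "R 15 = 0" "R 12 < n"
  shows "runs B count (R, mem mk) (\<lambda>t (R', M').
    t \<le> 5 + 8 * length (adj (R 12)) \<and> (\<forall>r. r \<notin> {5, 6, 7, 8, 9, 10} \<longrightarrow> R' r = R r) \<and>
    M' = mem mk \<and> R' 8 = card (choices mk (R 12)) \<and>
    (choices mk (R 12) \<noteq> {} \<longrightarrow> R' 10 \<in> choices mk (R 12)))"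
proof -
  let ?u = "R 12"
  let ?ys = "filter (\<lambda>y. mk y = 0) (adj ?u)"
  let ?R = "R(5 := off ?u, 6 := off (Suc ?u), 8 := 0)"
  have opt: "set ?ys = choices mk ?u"
    using set_adj[OF assms(4)] nbh_subset[OF graph] by (auto simp: choices_def avail_def)
  \<comment> \<open>Adjacency lists are distinct, so counting list entries counts vertices.\<close>
  have card: "length ?ys = card (choices mk ?u)"
    using distinct_card[of ?ys] distinct_adj[OF assms(4)] by (simp only: opt distinct_filter)
  have last: "choices mk ?u \<noteq> {} \<longrightarrow> last (R 10 # ?ys) \<in> choices mk ?u"
  proof
    assume "choices mk ?u \<noteq> {}"
    then have "?ys \<noteq> []"
      using opt by force
    then show "last (R 10 # ?ys) \<in> choices mk ?u"
      using last_in_set[of ?ys] by (simp only: last_ConsR opt not_False_eq_True)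
  qed
  have le: "off ?u + length (adj ?u) \<le> off n"
    using off_mono[of "Suc ?u" n] assms by (simp add: off_Suc)
  have "runs B count_loop (?R, mem mk) (\<lambda>t (R', M').
    t \<le> 1 + 8 * length (adj ?u) \<and> (\<forall>r. r \<notin> {5, 6, 7, 8, 9, 10} \<longrightarrow> R' r = ?R r) \<and> M' = mem mk \<and>
    R' 8 = ?R 8 + length ?ys \<and> R' 10 = last (?R 10 # ?ys))"
    using assms le off_le_B set_adj_subset[of ?u]
    by (intro runs_count_loop[of _ "off ?u"]) (auto simp: off_Suc mem_adj)
  then have "runs B count_loop (?R, mem mk) (\<lambda>t (R', M').
    t + 4 \<le> 5 + 8 * length (adj ?u) \<and> (\<forall>r. r \<notin> {5, 6, 7, 8, 9, 10} \<longrightarrow> R' r = R r) \<and>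
    M' = mem mk \<and> R' 8 = card (choices mk ?u) \<and> (choices mk ?u \<noteq> {} \<longrightarrow> R' 10 \<in> choices mk ?u))"
    by (rule runs_mono) (use last in \<open>auto simp: card simp del: last.simps\<close>)
  then show ?thesis
    using assms off_le_B by (simp add: count_def mem_off add.commute)
qed

lemma runs_scan_body:
  assumes "R 2 = 1" "R 3 = off n" "R 15 = 0" "R 12 = i" "i < n"
  shows "runs B scan_body (R, mem mk) (\<lambda>t (R', M').
    t \<le> 12 + 8 * length (adj i) \<and> M' = mem mk \<and>
    (\<forall>r. r \<notin> {5, 6, 7, 8, 9, 10, 11, 12, 13} \<longrightarrow> R' r = R r) \<and> R' 12 = Suc i \<and>
    R' 11 \<le> R 11 \<and> (i \<in> pending mk \<longrightarrow> R' 11 \<le> card (choices mk i)) \<and>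
    (R' 11 = R 11 \<and> R' 13 = R 13 \<or>
     i \<in> pending mk \<and> R' 11 = card (choices mk i) \<and> (choices mk i \<noteq> {} \<longrightarrow> R' 13 \<in> choices mk i)))"
proof (cases "mk i = 1")
  case True
  let ?R = "R(9 := 1)"
  have "runs B count (?R, mem mk) (\<lambda>t (R', M').
    t \<le> 5 + 8 * length (adj (?R 12)) \<and> (\<forall>r. r \<notin> {5, 6, 7, 8, 9, 10} \<longrightarrow> R' r = ?R r) \<and>
    M' = mem mk \<and> R' 8 = card (choices mk (?R 12)) \<and>
    (choices mk (?R 12) \<noteq> {} \<longrightarrow> R' 10 \<in> choices mk (?R 12)))"
    using assms by (intro runs_count) auto
  then show ?thesis
    unfolding scan_body_def using assms True off_le_B
    by (simp add: mem_mark) (erule runs_mono, auto simp: pending_def)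
next
  case False
  then show ?thesis
    unfolding scan_body_def using assms off_le_B
    by (simp add: mem_mark pending_def)
qed

text \<open>Induction on the number \<open>n - i\<close> of vertices still to be visited. The
  summand 13 is the cost 12 of the body apart from counting through the list, plus the loop
  test.\<close>

lemma runs_scan_loop:
  assumes "R 0 = n" "R 2 = 1" "R 3 = off n" "R 15 = 0" "R 12 = i" "i \<le> n"
  shows "runs B (While (Less 12 0) scan_body) (R, mem mk) (\<lambda>t (R', M').
    t \<le> 1 + (\<Sum>u\<in>{i..<n}. 13 + 8 * length (adj u)) \<and> M' = mem mk \<and>
    (\<forall>r. r \<notin> {5, 6, 7, 8, 9, 10, 11, 12, 13} \<longrightarrow> R' r = R r) \<and>
    R' 11 \<le> R 11 \<and> (\<forall>u\<in>pending mk. i \<le> u \<longrightarrow> R' 11 \<le> card (choices mk u)) \<and>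
    (R' 11 = R 11 \<and> R' 13 = R 13 \<or>
     (\<exists>u\<in>pending mk. R' 11 = card (choices mk u) \<and> (choices mk u \<noteq> {} \<longrightarrow> R' 13 \<in> choices mk u))))"
  using assms
proof (induction "n - i" arbitrary: i R)
  case 0
  then have "n \<le> i"
    by simp
  then have "\<not> i \<le> u" if "u \<in> pending mk" for u
    using that by (simp add: pending_def)
  with 0 show ?case
    by (subst runs_While) simp
next
  case (Suc d)
  then have i: "i < n"
    by simp
  have sum: "(\<Sum>u\<in>{i..<n}. 13 + 8 * length (adj u)) =
      13 + 8 * length (adj i) + (\<Sum>u\<in>{Suc i..<n}. 13 + 8 * length (adj u))"
    using i by (simp add: sum.atLeast_Suc_lessThan)
  show ?case
  proof (subst runs_While, subst if_P)
    show "holds (Less 12 0) (fst (R, mem mk))"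
      using Suc.prems i by simp
    show "runs B scan_body (R, mem mk) (\<lambda>t s'. runs B (While (Less 12 0) scan_body) s' (\<lambda>t' (R', M').
      1 + t + t' \<le> 1 + (\<Sum>u\<in>{i..<n}. 13 + 8 * length (adj u)) \<and> M' = mem mk \<and>
      (\<forall>r. r \<notin> {5, 6, 7, 8, 9, 10, 11, 12, 13} \<longrightarrow> R' r = R r) \<and>
      R' 11 \<le> R 11 \<and> (\<forall>u\<in>pending mk. i \<le> u \<longrightarrow> R' 11 \<le> card (choices mk u)) \<and>
      (R' 11 = R 11 \<and> R' 13 = R 13 \<or>
       (\<exists>u\<in>pending mk. R' 11 = card (choices mk u) \<and> (choices mk u \<noteq> {} \<longrightarrow> R' 13 \<in> choices mk u)))))"
    proof (rule runs_mono[OF runs_scan_body[OF Suc.prems(2-5) i]], clarify)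
      fix t R1
      assume t: "t \<le> 12 + 8 * length (adj i)"
        and R1: "\<forall>r. r \<notin> {5, 6, 7, 8, 9, 10, 11, 12, 13} \<longrightarrow> R1 r = R r" "R1 12 = Suc i"
        and le: "R1 11 \<le> R 11" "i \<in> pending mk \<longrightarrow> R1 11 \<le> card (choices mk i)"
        and opt: "R1 11 = R 11 \<and> R1 13 = R 13 \<or> i \<in> pending mk \<and> R1 11 = card (choices mk i) \<and>
          (choices mk i \<noteq> {} \<longrightarrow> R1 13 \<in> choices mk i)"
      show "runs B (While (Less 12 0) scan_body) (R1, mem mk) (\<lambda>t' (R', M').
        1 + t + t' \<le> 1 + (\<Sum>u\<in>{i..<n}. 13 + 8 * length (adj u)) \<and> M' = mem mk \<and>
        (\<forall>r. r \<notin> {5, 6, 7, 8, 9, 10, 11, 12, 13} \<longrightarrow> R' r = R r) \<and>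
        R' 11 \<le> R 11 \<and> (\<forall>u\<in>pending mk. i \<le> u \<longrightarrow> R' 11 \<le> card (choices mk u)) \<and>
        (R' 11 = R 11 \<and> R' 13 = R 13 \<or>
         (\<exists>u\<in>pending mk. R' 11 = card (choices mk u) \<and> (choices mk u \<noteq> {} \<longrightarrow> R' 13 \<in> choices mk u))))"
      proof (rule runs_mono[OF Suc.hyps(1)[of "Suc i" R1]], goal_cases)
        case (8 t' s')
        obtain R' M' where s': "s' = (R', M')"
          by fastforce
        have R': "R' 11 \<le> R1 11" "\<forall>u\<in>pending mk. Suc i \<le> u \<longrightarrow> R' 11 \<le> card (choices mk u)"
          "R' 11 = R1 11 \<and> R' 13 = R1 13 \<or>
           (\<exists>u\<in>pending mk. R' 11 = card (choices mk u) \<and> (choices mk u \<noteq> {} \<longrightarrow> R' 13 \<in> choices mk u))"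
          using 8 s' by auto
        \<comment> \<open>For \<open>u = i\<close> the bound comes from the body just executed,
          since register 11 never increases afterwards.\<close>
        have "\<forall>u\<in>pending mk. i \<le> u \<longrightarrow> R' 11 \<le> card (choices mk u)"
          using R'(1,2) le(2) by (metis le_trans not_less_eq_eq le_antisym)
        moreover have "R' 11 = R 11 \<and> R' 13 = R 13 \<or>
           (\<exists>u\<in>pending mk. R' 11 = card (choices mk u) \<and> (choices mk u \<noteq> {} \<longrightarrow> R' 13 \<in> choices mk u))"
          using R'(3) opt by metis
        ultimately show ?case
          using 8 s' t R1 le(1) R'(1) sum by auto
      qed (use Suc R1 i in auto)
    qed
  qed
qed

text \<open>The 3 accounts for two initial assignments and the failing loop test.\<close>

definition scan_time :: nat where
  "scan_time = 3 + (\<Sum>u<n. 13 + 8 * length (adj u))"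

text \<open>Register 11 is the minimum of 2 and the numbers of choices, expressed by bound and
  attainment so that no minimum over a possibly empty set is needed. With value 1, register 13 is
  the only choice of some pending vertex.\<close>

definition scanned :: "(nat \<Rightarrow> nat) \<Rightarrow> (nat \<Rightarrow> nat) \<Rightarrow> bool" where
  "scanned mk R \<longleftrightarrow> R 11 \<le> 2 \<and> (\<forall>u\<in>pending mk. R 11 \<le> card (choices mk u)) \<and>
    (R 11 = 2 \<or>
     (\<exists>u\<in>pending mk. R 11 = card (choices mk u) \<and> (choices mk u \<noteq> {} \<longrightarrow> R 13 \<in> choices mk u)))"

definition regs :: "(nat \<Rightarrow> nat) \<Rightarrow> bool" where
  "regs R \<longleftrightarrow> R 0 = n \<and> R 2 = 1 \<and> R 3 = off n \<and> R 4 = 2 \<and> R 15 = 0"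

lemma runs_scan:
  assumes "regs R"
  shows "runs B scan (R, mem mk) (\<lambda>t (R', M').
    t \<le> scan_time \<and> M' = mem mk \<and> regs R' \<and> scanned mk R')"
proof -
  let ?R = "R(11 := 2, 12 := 0)"
  have "runs B (While (Less 12 0) scan_body) (?R, mem mk) (\<lambda>t (R', M').
    t \<le> 1 + (\<Sum>u\<in>{0..<n}. 13 + 8 * length (adj u)) \<and> M' = mem mk \<and>
    (\<forall>r. r \<notin> {5, 6, 7, 8, 9, 10, 11, 12, 13} \<longrightarrow> R' r = ?R r) \<and>
    R' 11 \<le> ?R 11 \<and> (\<forall>u\<in>pending mk. 0 \<le> u \<longrightarrow> R' 11 \<le> card (choices mk u)) \<and>
    (R' 11 = ?R 11 \<and> R' 13 = ?R 13 \<or>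
     (\<exists>u\<in>pending mk. R' 11 = card (choices mk u) \<and> (choices mk u \<noteq> {} \<longrightarrow> R' 13 \<in> choices mk u))))"
    using assms by (intro runs_scan_loop) (auto simp: regs_def)
  then have "runs B (While (Less 12 0) scan_body) (?R, mem mk) (\<lambda>t (R', M').
    2 + t \<le> scan_time \<and> M' = mem mk \<and> regs R' \<and> scanned mk R')"
    by (rule runs_mono) (use assms in \<open>auto simp: scan_time_def scanned_def regs_def lessThan_atLeast0\<close>)
  then show ?thesis
    using assms by (simp add: scan_def regs_def)
qed

section \<open>Unit propagation and the complete program\<close>

text \<open>Each round settles at least the vertex that forced the choice, so the number of pending
  vertices bounds the number of rounds. A round costs one test, a fill of at most
  \<open>4 + 5 * n\<close>, and a scan.\<close>

lemma runs_propagate: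
  assumes "regs R" "scanned mk R" "pending mk \<subseteq> nbh E v" "avail mk \<subseteq> {..<n} - closed_nbh E v"
    and "\<not> has_cycle E 4" "\<not> has_cycle E 6"
  shows "runs B propagate (R, mem mk) (\<lambda>t (R', M').
    t \<le> 1 + card (pending mk) * (5 + 5 * n + scan_time) \<and> R' 15 = 0 \<and>
    (R' 11 = 0 \<longleftrightarrow> \<not> indep_dominable E (pending mk) (avail mk)))"
  using assms(1-4)
proof (induction "card (pending mk)" arbitrary: R mk rule: less_induct)
  case less
  have fin: "finite (pending mk)"
    by (simp add: pending_def)
  consider "R 11 = 0" | "R 11 = 1" | "R 11 = 2"
    using less.prems(2) unfolding scanned_def by linarith
  then show ?case
  proof cases
    case 1
    then obtain u where "u \<in> pending mk" "choices mk u = {}"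
      using less.prems(2) finite_choices unfolding scanned_def by auto
    then have "\<not> indep_dominable E (pending mk) (avail mk)"
      using not_indep_dominable[of u "pending mk" E "avail mk"] by (simp add: choices_def)
    then show ?thesis
      unfolding propagate_def using 1 less.prems(1)
      by (subst runs_While) (simp add: regs_def)
  next
    case 2
    then obtain u where u: "u \<in> pending mk" "card (choices mk u) = 1" "R 13 \<in> choices mk u"
      using less.prems(2) unfolding scanned_def by force
    define x where "x = R 13"
    define mk' where "mk' = (\<lambda>z. if z \<in> nbh E x then 2 else mk z)"
    obtain y where "choices mk u = {y}"
      using u(2) by (rule card_1_singletonE)
    then have x: "choices mk u = {x}"
      using u(3) by (simp add: x_def)
    have "x < n"
      using u(3) by (simp add: x_def choices_def avail_def)
    \<comment> \<open>The new marks encode exactly the reduced instance of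
      \<open>indep_dominable_forced\<close>; \<open>x\<close> keeps mark 0 and stays
      available.\<close>
    have eqs: "pending mk' = pending mk - nbh E x" "avail mk' = avail mk - nbh E x"
      by (auto simp: pending_def avail_def mk'_def)
    have equiv: "indep_dominable E (pending mk) (avail mk) \<longleftrightarrow>
        indep_dominable E (pending mk') (avail mk')"
      unfolding eqs using x by (intro indep_dominable_forced[OF graph u(1)]) (simp add: choices_def)
    have "u \<in> nbh E x"
      using x nbh_sym[of x E u] by (auto simp: choices_def)
    then have less_card: "card (pending mk') < card (pending mk)"
      unfolding eqs using u(1) fin by (intro psubset_card_mono) auto
    have "length (adj x) \<le> n"
      using distinct_card[OF distinct_adj[OF \<open>x < n\<close>]] card_mono[OF _ set_adj_subset[OF \<open>x < n\<close>]] by simp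
    moreover have "runs B (fill 13 4) (R, mem mk) (\<lambda>t (R', M').
      t = 4 + 5 * length (adj (R 13)) \<and> (\<forall>r. r \<notin> {5, 6, 7} \<longrightarrow> R' r = R r) \<and>
      M' = mem (\<lambda>z. if z \<in> nbh E (R 13) then R 4 else mk z))"
      using less.prems(1) \<open>x < n\<close> by (intro runs_fill) (auto simp: regs_def x_def)
    ultimately have fill: "runs B (fill 13 4) (R, mem mk) (\<lambda>t (R', M').
      t \<le> 4 + 5 * n \<and> regs R' \<and> M' = mem mk')"
      by (elim runs_mono) (use less.prems(1) in \<open>auto simp: regs_def mk'_def x_def cong: if_cong\<close>)
    have IH: "runs B propagate (R2, mem mk') (\<lambda>t (R', M').
      t \<le> 1 + card (pending mk') * (5 + 5 * n + scan_time) \<and> R' 15 = 0 \<and>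
      (R' 11 = 0 \<longleftrightarrow> \<not> indep_dominable E (pending mk') (avail mk')))"
      if "regs R2" "scanned mk' R2" for R2
      using less.prems(3,4) by (intro less.hyps less_card that) (auto simp: eqs)
    have time: "1 + (t1 + t2) + t3 \<le> 1 + card (pending mk) * (5 + 5 * n + scan_time)"
      if "t1 \<le> 4 + 5 * n" "t2 \<le> scan_time" "t3 \<le> 1 + card (pending mk') * (5 + 5 * n + scan_time)"
      for t1 t2 t3
    proof -
      have "1 + (t1 + t2) + t3 \<le> 1 + Suc (card (pending mk')) * (5 + 5 * n + scan_time)"
        using that by simp
      also have "\<dots> \<le> 1 + card (pending mk) * (5 + 5 * n + scan_time)"
        using less_card by (intro add_left_mono mult_right_mono) auto
      finally show ?thesis .
    qed
    have "runs B (Seq (fill 13 4) scan) (R, mem mk) (\<lambda>t (R', M').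
      (\<exists>t1 t2. t = t1 + t2 \<and> t1 \<le> 4 + 5 * n \<and> t2 \<le> scan_time) \<and>
      regs R' \<and> scanned mk' R' \<and> M' = mem mk')"
      unfolding runs_Seq by (rule runs_mono[OF fill], clarify, rule runs_mono[OF runs_scan]) auto
    then have "runs B (Seq (fill 13 4) scan) (R, mem mk) (\<lambda>t s'.
      runs B propagate s' (\<lambda>t' (R', M').
        1 + t + t' \<le> 1 + card (pending mk) * (5 + 5 * n + scan_time) \<and> R' 15 = 0 \<and>
        (R' 11 = 0 \<longleftrightarrow> \<not> indep_dominable E (pending mk) (avail mk))))"
      by (rule runs_mono, clarify, intro runs_mono[OF IH]) (auto simp only: equiv intro: time)
    moreover have "holds (Eq 11 2) (fst (R, mem mk))"
      using 2 less.prems(1) by (simp add: regs_def)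
    ultimately show ?thesis
      unfolding propagate_def by (subst runs_While) (simp only: if_True)
  next
    case 3
    have "indep_dominable E (pending mk) (avail mk)"
    proof (rule indep_dominable_greedy[OF graph assms(5,6) fin less.prems(3,4)])
      \<comment> \<open>With two choices everywhere, the greedy condition on vertices with fewer
        than two choices holds vacuously.\<close>
      have two: "2 \<le> card (nbh E u \<inter> avail mk)" if "u \<in> pending mk" for u
        using less.prems(2) 3 that by (simp add: scanned_def choices_def)
      show "nbh E u \<inter> avail mk \<noteq> {}" if "u \<in> pending mk" for u
        using two[OF that] by auto
      show "u = w" if "u \<in> pending mk" "card (nbh E u \<inter> avail mk) < 2" for u w
        using two[OF that(1)] that(2) by simp
    qed
    then show ?thesis
      unfolding propagate_def using 3 less.prems(1)
      by (subst runs_While) (simp add: regs_def)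
  qed
qed

lemma runs_setup_marks:
  assumes "v < n"
  shows "runs B setup_marks (input_state n adj v) (\<lambda>t (R', M'). t \<le> 9 + 5 * n \<and> regs R' \<and>
    M' = mem (\<lambda>z. if z \<in> nbh E v then 1 else if z = v then 2 else 0))"
proof -
  let ?R = "(\<lambda>_. 0)(0 := n, 1 := v, 2 := 1, 3 := off n, 4 := 2, 5 := v + off n) :: nat \<Rightarrow> nat"
  have "length (adj v) \<le> n"
    using distinct_card[OF distinct_adj[OF assms]] card_mono[OF _ set_adj_subset[OF assms]] by simp
  moreover have "runs B (fill 1 2) (?R, mem ((\<lambda>_. 0)(v := 2))) (\<lambda>t (R', M').
    t = 4 + 5 * length (adj (?R 1)) \<and> (\<forall>r. r \<notin> {5, 6, 7} \<longrightarrow> R' r = ?R r) \<and>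
    M' = mem (\<lambda>z. if z \<in> nbh E (?R 1) then ?R 2 else ((\<lambda>_. 0)(v := 2)) z))"
    using assms by (intro runs_fill) auto
  ultimately have "runs B (fill 1 2) (?R, mem ((\<lambda>_. 0)(v := 2))) (\<lambda>t (R', M'). 5 + t \<le> 9 + 5 * n \<and>
    regs R' \<and> M' = mem (\<lambda>z. if z \<in> nbh E v then 1 else if z = v then 2 else 0))"
    by (elim runs_mono) (auto simp: regs_def intro!: arg_cong[of _ _ mem])
  then show ?thesis
    unfolding setup_marks_def input_state_eq using assms off_le_B B(1)
    by (simp add: mem_off mem_update)
qed

text \<open>The constant 12 consists of 9 for the setup, 1 for the last test of the propagation loop
  and 2 for the final branch.\<close>

lemma runs_shedding_program:
  assumes "v < n" "\<not> has_cycle E 4" "\<not> has_cycle E 6"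
  shows "runs B shedding_program (input_state n adj v) (\<lambda>t s.
    t \<le> 12 + 5 * n + scan_time + n * (5 + 5 * n + scan_time) \<and>
    answer s = (if shedding {..<n} E v then 1 else 0))"
proof -
  define mk where "mk = (\<lambda>z. if z \<in> nbh E v then 1 else if z = v then 2 else 0 :: nat)"
  \<comment> \<open>The initial marks encode the instance that characterises shedding.\<close>
  have sets: "pending mk = nbh E v" "avail mk = {..<n} - closed_nbh E v"
    using nbh_subset[OF graph, of v] nbh_irrefl[OF graph, of v]
    by (auto simp: pending_def avail_def mk_def closed_nbh_def)
  have card: "card (pending mk) \<le> n"
    using card_mono[of "{..<n}" "pending mk"] by (auto simp: pending_def)
  note shed = shedding_iff_not_indep_dominable[OF graph, of v, folded sets]
  have time: "t1 + (t2 + (t3 + 2)) \<le> 12 + 5 * n + scan_time + n * (5 + 5 * n + scan_time)"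
    if "t1 \<le> 9 + 5 * n" "t2 \<le> scan_time" "t3 \<le> 1 + card (pending mk) * (5 + 5 * n + scan_time)"
    for t1 t2 t3
    using that mult_right_mono[OF card, of "5 + 5 * n + scan_time"] by linarith
  have propagate: "runs B propagate (R, mem mk) (\<lambda>t (R', M').
    t \<le> 1 + card (pending mk) * (5 + 5 * n + scan_time) \<and> R' 15 = 0 \<and>
    (R' 11 = 0 \<longleftrightarrow> \<not> indep_dominable E (pending mk) (avail mk)))"
    if "regs R" "scanned mk R" for R
    by (rule runs_propagate[OF that _ _ assms(2,3), of v]) (simp_all add: sets)
  have final: "runs B (If (Eq 11 15) (Imm 0 1) (Imm 0 0)) (R, M) (\<lambda>t s. t = 2 \<and>
      answer s = (if shedding {..<n} E v then 1 else 0))"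
    if "R 15 = 0" "R 11 = 0 \<longleftrightarrow> \<not> indep_dominable E (pending mk) (avail mk)" for R M
    using that B(1) by (auto simp: answer_def shed)
  show ?thesis
    unfolding shedding_program_def runs_Seq
    by (rule runs_mono[OF runs_setup_marks[OF assms(1), folded mk_def]], clarify,
      rule runs_mono[OF runs_scan], assumption, clarify,
      rule runs_mono[OF propagate], assumption, assumption, clarify,
      rule runs_mono[OF final]) (auto simp only: prod.case intro!: time)
qed

end

section \<open>Time and word size in terms of vertices and edges\<close>

theorem theorem7p1:
  "\<exists>(P :: com) (C :: nat) (k :: nat).
     \<forall>(n :: nat) (E :: nat set set) (adj :: nat \<Rightarrow> nat list) (v :: nat).
       simple_graph {..<n} E \<and> \<not> has_cycle E 4 \<and> \<not> has_cycle E 6 \<and> v \<in> {..<n} \<and>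
       adjacency_lists n E adj \<longrightarrow>
       (\<exists>t s. exec ((n + card E + 1) ^ k) P (input_state n adj v) t s \<and>
              t \<le> C * (n * (n + card E)) \<and>
              answer s = (if shedding {..<n} E v then 1 else 0))"
\<comment> \<open>With \<open>m\<close> edges the time is at most
  \<open>15 + 26 * n + 16 * m + 18 * (n * n) + 16 * (n * m)\<close>. As \<open>n\<close> is
  positive, lower terms are absorbed, giving coefficients 59 for \<open>n * n\<close> and 32 for
  \<open>n * m\<close>, both below 60.\<close>
proof (rule exI[of _ shedding_program], rule exI[of _ 60], rule exI[of _ 2], intro allI impI,
    elim conjE)
  fix n v :: nat and E :: "nat set set" and adj :: "nat \<Rightarrow> nat list"
  assume graph: "simple_graph {..<n} E" and cycles: "\<not> has_cycle E 4" "\<not> has_cycle E 6"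
    and v: "v \<in> {..<n}" and adj: "adjacency_lists n E adj"
  define m where "m = card E"
  have len: "(\<Sum>u<n. length (adj u)) = 2 * m"
    using sum_card_nbh[OF graph] adj unfolding adjacency_lists_def m_def
    by (metis (no_types, lifting) distinct_card lessThan_iff sum.cong)
  \<comment> \<open>The largest number needed is at most \<open>2 * n + 2 * m + 1\<close>, and
    \<open>n + m + 1\<close> is at least 2, so the exponent 2 suffices for the word bound.\<close>
  have "2 * (n + m + 1) \<le> (n + m + 1) * (n + m + 1)"
    using v by (intro mult_right_mono) auto
  then interpret ram_input n E adj "(n + m + 1) ^ 2"
    using graph adj len v by unfold_locales (auto simp: power2_eq_square)
  have scan_time: "scan_time = 3 + 13 * n + 16 * m"
    by (simp add: scan_time_def sum.distrib len flip: sum_distrib_left)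
  have "1 \<le> n"
    using v by auto
  then have "1 \<le> n * n" "n \<le> n * n" "m \<le> n * m"
    by simp_all
  moreover have "n * (5 + 5 * n + scan_time) = 8 * n + 18 * (n * n) + 16 * (n * m)"
    "60 * (n * (n + m)) = 60 * (n * n) + 60 * (n * m)"
    unfolding scan_time by (simp_all add: algebra_simps)
  ultimately have "12 + 5 * n + scan_time + n * (5 + 5 * n + scan_time) \<le> 60 * (n * (n + m))"
    unfolding scan_time by linarith
  then have "runs ((n + m + 1) ^ 2) shedding_program (input_state n adj v) (\<lambda>t s.
    t \<le> 60 * (n * (n + m)) \<and> answer s = (if shedding {..<n} E v then 1 else 0))"
    using v cycles by (intro runs_mono[OF runs_shedding_program]) auto
  then show "\<exists>t s. exec ((n + card E + 1) ^ 2) shedding_program (input_state n adj v) t s \<and>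
      t \<le> 60 * (n * (n + card E)) \<and> answer s = (if shedding {..<n} E v then 1 else 0)"
    unfolding runs_def m_def .
qed

end
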